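(* Let $F$ be a field and let $A$ be an $F$-algebra. The following conditions are equivalent: (i) $A$ is two-sided zero product determined. (ii) If $\Phi:A\times A\to X$, where $X$ is any vector space over $F$, is a bilinear map with the property that for all $x,y\in A$, $xy=yx=0$ implies $\Phi(x,y)=0$, then there exists a linear map $T:[A,A]\to X$ such that $\Phi(x,y)-\Phi(xy,1)=T([x,y])$ for all $x,y\in A$. (iii) $A$ is zero Lie product determined and for all $z,w\in A$, $[z,w]=0$ implies $z\otimes w-zw\otimes 1\in (A\otimes A)_0$.
   Context: $F$ is an arbitrary field; an algebra means an associative $F$-algebra with unity $1$; $A\otimes A$ is the tensor product over $F$. For $x,y\in A$, $[x,y]=xy-yx$, and $[A,A]$ denotes the linear span of all commutators $[x,y]$, $x,y\in A$. The subspace $(A\otimes A)_0$ of $A\otimes A$ is the linear span of $\{x\otimes y \mid x,y\in A,\ xy=yx=0\}$. An algebra $A$ is two-sided zero product determined (2-zpd) if every bilinear functional $\varphi:A\times A\to F$ with the property that for all $x,y\in A$, $xy=yx=0$ implies $\varphi(x,y)=0$, is of the form $\varphi(x,y)=\tau_1(xy)+\tau_2(yx)$ (for all $x,y\in A$) for some linear functionals $\tau_1,\tau_2$ on $A$. An algebra $A$ is zero Lie product determined (zLpd) if every bilinear functional $\varphi:A\times A\to F$ with the property that for all $x,y\in A$, $[x,y]=0$ implies $\varphi(x,y)=0$, is of the form $\varphi(x,y)=\tau([x,y])$ (for all $x,y\in A$) for some linear functional $\tau$. *)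

theory Defs
  imports Complex_Main "HOL-Library.Poly_Mapping"
begin

section \<open>Algebras over a field\<close>

text \<open>
  The sort \<open>{ring, monoid_mult}\<close> (rather than \<open>ring_1\<close>) gives an associative ring with \<open>1\<close> without
  requiring \<open>0 \<noteq> 1\<close>, so the zero algebra is included.
\<close>

locale unital_algebra = vector_space scale
  for scale :: "'f::field \<Rightarrow> 'a::{ring, monoid_mult} \<Rightarrow> 'a" +
  assumes mult_scale_left: "scale c x * y = scale c (x * y)"
    and mult_scale_right: "x * scale c y = scale c (x * y)"

definition commutator :: "'a::ring \<Rightarrow> 'a \<Rightarrow> 'a"
  where "commutator x y = x * y - y * x"

definition commutator_space :: "('f::field \<Rightarrow> 'a::ring \<Rightarrow> 'a) \<Rightarrow> 'a set"
  where "commutator_space scale = module.span scale {commutator x y | x y. True}"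


section \<open>Linear and bilinear maps\<close>

definition bilinear_map ::
  "('f::field \<Rightarrow> 'a::ab_group_add \<Rightarrow> 'a) \<Rightarrow> ('f \<Rightarrow> 'x::ab_group_add \<Rightarrow> 'x) \<Rightarrow> ('a \<Rightarrow> 'a \<Rightarrow> 'x) \<Rightarrow> bool"
  where "bilinear_map scale scaleX \<Phi> \<longleftrightarrow>
    (\<forall>x. Vector_Spaces.linear scale scaleX (\<lambda>y. \<Phi> x y)) \<and>
    (\<forall>y. Vector_Spaces.linear scale scaleX (\<lambda>x. \<Phi> x y))"

abbreviation linear_functional :: "('f::field \<Rightarrow> 'a::ab_group_add \<Rightarrow> 'a) \<Rightarrow> ('a \<Rightarrow> 'f) \<Rightarrow> bool"
  where "linear_functional scale \<equiv> Vector_Spaces.linear scale (*)"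

abbreviation bilinear_functional :: "('f::field \<Rightarrow> 'a::ab_group_add \<Rightarrow> 'a) \<Rightarrow> ('a \<Rightarrow> 'a \<Rightarrow> 'f) \<Rightarrow> bool"
  where "bilinear_functional scale \<equiv> bilinear_map scale (*)"

text \<open>Linearity of a map whose domain is the subspace \<open>S\<close>; values outside \<open>S\<close> are irrelevant.\<close>

definition linear_map_on ::
  "('f::field \<Rightarrow> 'a::ab_group_add \<Rightarrow> 'a) \<Rightarrow> ('f \<Rightarrow> 'x::ab_group_add \<Rightarrow> 'x) \<Rightarrow> 'a set \<Rightarrow> ('a \<Rightarrow> 'x) \<Rightarrow> bool"
  where "linear_map_on scale scaleX S T \<longleftrightarrow>
    (\<forall>u\<in>S. \<forall>v\<in>S. T (u + v) = T u + T v) \<and> (\<forall>c. \<forall>u\<in>S. T (scale c u) = scaleX c (T u))"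


section \<open>Zero (Lie) product determined algebras\<close>

definition vanishes_on_zero_products :: "('a::ring \<Rightarrow> 'a \<Rightarrow> 'x::zero) \<Rightarrow> bool"
  where "vanishes_on_zero_products \<Phi> \<longleftrightarrow> (\<forall>x y. x * y = 0 \<and> y * x = 0 \<longrightarrow> \<Phi> x y = 0)"

definition two_sided_zpd :: "('f::field \<Rightarrow> 'a::{ring, monoid_mult} \<Rightarrow> 'a) \<Rightarrow> bool"
  where "two_sided_zpd scale \<longleftrightarrow>
    (\<forall>\<phi>. bilinear_functional scale \<phi> \<and> vanishes_on_zero_products \<phi> \<longrightarrow>
      (\<exists>\<tau>\<^sub>1 \<tau>\<^sub>2. linear_functional scale \<tau>\<^sub>1 \<and> linear_functional scale \<tau>\<^sub>2 \<and>
        (\<forall>x y. \<phi> x y = \<tau>\<^sub>1 (x * y) + \<tau>\<^sub>2 (y * x))))"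

definition zero_Lie_product_determined :: "('f::field \<Rightarrow> 'a::{ring, monoid_mult} \<Rightarrow> 'a) \<Rightarrow> bool"
  where "zero_Lie_product_determined scale \<longleftrightarrow>
    (\<forall>\<phi>. bilinear_functional scale \<phi> \<and> (\<forall>x y. commutator x y = 0 \<longrightarrow> \<phi> x y = 0) \<longrightarrow>
      (\<exists>\<tau>. linear_functional scale \<tau> \<and> (\<forall>x y. \<phi> x y = \<tau> (commutator x y))))"

text \<open>
  The factorization property of bilinear maps into one given vector space \<open>X\<close>, here the type \<open>'x\<close>
  with scalar multiplication \<open>scaleX\<close>.  HOL formulas cannot quantify over types, so ``for every
  vector space \<open>X\<close>'' is rendered by letting \<open>X\<close> range over the field itself and over all vector
  spaces on a type \<open>'x\<close>, with \<open>'x\<close> a free type variable of the theorem.  As \<open>'x\<close> is arbitrary, the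
  implication towards this condition covers every \<open>X\<close>; and in the converse implication the property
  is assumed only for some of the spaces \<open>X\<close>, so nothing is lost there either.
\<close>

definition factors_via_commutators ::
  "('f::field \<Rightarrow> 'a::{ring, monoid_mult} \<Rightarrow> 'a) \<Rightarrow> ('f \<Rightarrow> 'x::ab_group_add \<Rightarrow> 'x) \<Rightarrow> bool"
  where "factors_via_commutators scale scaleX \<longleftrightarrow>
    (\<forall>\<Phi>. bilinear_map scale scaleX \<Phi> \<and> vanishes_on_zero_products \<Phi> \<longrightarrow>
      (\<exists>T. linear_map_on scale scaleX (commutator_space scale) T \<and>
        (\<forall>x y. \<Phi> x y - \<Phi> (x * y) 1 = T (commutator x y))))"


section \<open>Quotients of vector spaces\<close>

text \<open>
  The quotient of a vector space by a subspace \<open>N\<close> has the cosets of \<open>N\<close> as elements.  It is a set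
  and not a type, since \<open>N\<close> depends on a term variable (the scalar multiplication of the algebra).
  The operations on cosets are induced by representatives.
\<close>

definition coset :: "'v::ab_group_add set \<Rightarrow> 'v \<Rightarrow> 'v set"
  where "coset N u = {v. v - u \<in> N}"

definition coset_add :: "'v::ab_group_add set \<Rightarrow> 'v set \<Rightarrow> 'v set \<Rightarrow> 'v set"
  where "coset_add N U V = (\<Union>u\<in>U. \<Union>v\<in>V. coset N (u + v))"

definition coset_diff :: "'v::ab_group_add set \<Rightarrow> 'v set \<Rightarrow> 'v set \<Rightarrow> 'v set"
  where "coset_diff N U V = (\<Union>u\<in>U. \<Union>v\<in>V. coset N (u - v))"

definition coset_scale ::
  "('f::field \<Rightarrow> 'v::ab_group_add \<Rightarrow> 'v) \<Rightarrow> 'v set \<Rightarrow> 'f \<Rightarrow> 'v set \<Rightarrow> 'v set"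
  where "coset_scale s N c U = (\<Union>u\<in>U. coset N (s c u))"

text \<open>The linear span of a set \<open>S\<close> of cosets, in the quotient space.\<close>

inductive_set coset_span ::
  "('f::field \<Rightarrow> 'v::ab_group_add \<Rightarrow> 'v) \<Rightarrow> 'v set \<Rightarrow> 'v set set \<Rightarrow> 'v set set"
  for s :: "'f::field \<Rightarrow> 'v::ab_group_add \<Rightarrow> 'v" and N :: "'v set" and S :: "'v set set"
  where
    zero: "coset N 0 \<in> coset_span s N S"
  | base: "U \<in> S \<Longrightarrow> U \<in> coset_span s N S"
  | add: "U \<in> coset_span s N S \<Longrightarrow> V \<in> coset_span s N S \<Longrightarrow> coset_add N U V \<in> coset_span s N S"
  | scale: "U \<in> coset_span s N S \<Longrightarrow> coset_scale s N c U \<in> coset_span s N S"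

context vector_space
begin

lemma coset_eq_iff:
  assumes "subspace N"
  shows "coset N u = coset N v \<longleftrightarrow> u - v \<in> N"
proof
  assume "coset N u = coset N v"
  moreover have "u \<in> coset N u"
    using assms by (simp add: coset_def subspace_0)
  ultimately show "u - v \<in> N"
    by (simp add: coset_def)
next
  assume uv: "u - v \<in> N"
  have "w - u \<in> N \<longleftrightarrow> w - v \<in> N" for w
    using subspace_add[OF assms, of "w - u" "u - v"] subspace_diff[OF assms, of "w - v" "u - v"] uv
    by auto
  then show "coset N u = coset N v"
    by (simp add: coset_def)
qed

lemma coset_add_coset:
  assumes "subspace N"
  shows "coset_add N (coset N u) (coset N v) = coset N (u + v)"
proof -
  have "coset N (u' + v') = coset N (u + v)" if "u' \<in> coset N u" "v' \<in> coset N v" for u' v'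
    unfolding coset_eq_iff[OF assms]
    using subspace_add[OF assms, of "u' - u" "v' - v"] that
    by (simp add: coset_def algebra_simps)
  moreover have "u \<in> coset N u" "v \<in> coset N v"
    using assms by (simp_all add: coset_def subspace_0)
  ultimately show ?thesis
    unfolding coset_add_def by blast
qed

lemma coset_diff_coset:
  assumes "subspace N"
  shows "coset_diff N (coset N u) (coset N v) = coset N (u - v)"
proof -
  have "coset N (u' - v') = coset N (u - v)" if "u' \<in> coset N u" "v' \<in> coset N v" for u' v'
    unfolding coset_eq_iff[OF assms]
    using subspace_diff[OF assms, of "u' - u" "v' - v"] that
    by (simp add: coset_def algebra_simps)
  moreover have "u \<in> coset N u" "v \<in> coset N v"
    using assms by (simp_all add: coset_def subspace_0)
  ultimately show ?thesis
    unfolding coset_diff_def by blast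
qed

lemma coset_scale_coset:
  assumes "subspace N"
  shows "coset_scale scale N c (coset N u) = coset N (scale c u)"
proof -
  have "coset N (scale c u') = coset N (scale c u)" if "u' \<in> coset N u" for u'
    unfolding coset_eq_iff[OF assms]
    using subspace_scale[OF assms, of "u' - u" c] that
    by (simp add: coset_def scale_right_diff_distrib)
  moreover have "u \<in> coset N u"
    using assms by (simp add: coset_def subspace_0)
  ultimately show ?thesis
    unfolding coset_scale_def by blast
qed

end


section \<open>The tensor product of an algebra with itself\<close>

text \<open>
  \<open>A \<otimes> A\<close> is the free vector space on \<open>A \<times> A\<close>, i.e. the finitely supported functions
  \<open>'a \<times> 'a \<Rightarrow>\<^sub>0 'f\<close>, modulo the span of the bilinearity relations.
\<close>

definition free_scale :: "'f::field \<Rightarrow> ('k \<Rightarrow>\<^sub>0 'f) \<Rightarrow> ('k \<Rightarrow>\<^sub>0 'f)"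
  where "free_scale c = Poly_Mapping.map ((*) c)"

lemma lookup_free_scale: "Poly_Mapping.lookup (free_scale c p) k = c * Poly_Mapping.lookup p k"
  by (simp add: free_scale_def Poly_Mapping.map.rep_eq when_def)

lemma vector_space_free_scale: "vector_space free_scale"
  by unfold_locales (auto intro!: poly_mapping_eqI simp: lookup_free_scale lookup_add algebra_simps)

definition tensor_relations ::
  "('f::field \<Rightarrow> 'a::ring \<Rightarrow> 'a) \<Rightarrow> ('a \<times> 'a \<Rightarrow>\<^sub>0 'f) set"
  where "tensor_relations scale = module.span free_scale (
    {Poly_Mapping.single (x + x', y) 1 - (Poly_Mapping.single (x, y) 1 + Poly_Mapping.single (x', y) 1)
      | x x' y. True} \<union>
    {Poly_Mapping.single (x, y + y') 1 - (Poly_Mapping.single (x, y) 1 + Poly_Mapping.single (x, y') 1)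
      | x y y'. True} \<union>
    {Poly_Mapping.single (scale c x, y) 1 - free_scale c (Poly_Mapping.single (x, y) 1) | c x y. True} \<union>
    {Poly_Mapping.single (x, scale c y) 1 - free_scale c (Poly_Mapping.single (x, y) 1) | c x y. True})"

definition tensor :: "('f::field \<Rightarrow> 'a::ring \<Rightarrow> 'a) \<Rightarrow> 'a \<Rightarrow> 'a \<Rightarrow> ('a \<times> 'a \<Rightarrow>\<^sub>0 'f) set"
  where "tensor scale x y = coset (tensor_relations scale) (Poly_Mapping.single (x, y) 1)"

definition tensor_diff ::
  "('f::field \<Rightarrow> 'a::ring \<Rightarrow> 'a) \<Rightarrow> ('a \<times> 'a \<Rightarrow>\<^sub>0 'f) set \<Rightarrow> ('a \<times> 'a \<Rightarrow>\<^sub>0 'f) set \<Rightarrow> ('a \<times> 'a \<Rightarrow>\<^sub>0 'f) set"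
  where "tensor_diff scale = coset_diff (tensor_relations scale)"

definition tensor_span ::
  "('f::field \<Rightarrow> 'a::ring \<Rightarrow> 'a) \<Rightarrow> ('a \<times> 'a \<Rightarrow>\<^sub>0 'f) set set \<Rightarrow> ('a \<times> 'a \<Rightarrow>\<^sub>0 'f) set set"
  where "tensor_span scale = coset_span free_scale (tensor_relations scale)"

text \<open>The subspace \<open>(A \<otimes> A)\<^sub>0\<close> of \<open>A \<otimes> A\<close>.\<close>

definition tensor_zero_products ::
  "('f::field \<Rightarrow> 'a::ring \<Rightarrow> 'a) \<Rightarrow> ('a \<times> 'a \<Rightarrow>\<^sub>0 'f) set set"
  where "tensor_zero_products scale =
    tensor_span scale {tensor scale x y | x y. x * y = 0 \<and> y * x = 0}"

end

theory Submission
  imports Defs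
begin

text \<open>
  A tensor lies in \<open>(A \<otimes> A)\<^sub>0\<close> iff every bilinear functional vanishing on the pairs with
  \<open>x y = y x = 0\<close> kills it, since a subspace is cut out by the linear functionals that vanish on it.
  Hence the tensor condition of (iii) says that \<open>\<phi> z w = \<phi> (z w) 1\<close> for all such \<open>\<phi>\<close> and all
  commuting \<open>z, w\<close>, so that \<open>\<phi> x y - \<phi> (x y) 1\<close> vanishes on commuting pairs.  For (ii), composing
  \<open>\<Phi>\<close> with the functionals on \<open>X\<close> reduces the identity \<open>\<Phi> x y - \<Phi> (x y) 1 = T [x, y]\<close> to the
  scalar-valued case.
\<close>

section \<open>Linear functionals\<close>

lemma vector_space_field: "vector_space ((*) :: 'f::field \<Rightarrow> 'f \<Rightarrow> 'f)"
  by unfold_locales (simp_all add: algebra_simps)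

text \<open>A basis \<open>B\<close> of \<open>span S\<close> stays independent after inserting
  \<open>u\<close>, so a functional may be prescribed as 1 at \<open>u\<close> and 0 on
  \<open>B\<close>.\<close>

lemma (in vector_space) separating_functional:
  assumes "u \<notin> span S"
  obtains f where "linear_functional scale f" "\<And>v. v \<in> span S \<Longrightarrow> f v = 0" "f u \<noteq> 0"
proof -
  interpret vector_space_pair scale "(*)"
    by (intro vector_space_pair.intro vector_space_field vector_space_axioms)
  obtain B where B: "B \<subseteq> S" "independent B" "S \<subseteq> span B"
    using maximal_independent_subset by blast
  have span: "span S = span B"
    using B by (metis span_mono span_span subset_antisym)
  have "independent (insert u B)"
    using assms B(2) span by (simp add: independent_insertI)
  then obtain g where g: "linear_functional scale g"
      "\<forall>x\<in>insert u B. g x = (if x = u then 1 else 0)"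
    using linear_independent_extend[of "insert u B" "\<lambda>x. if x = u then 1 else 0"] by blast
  have "u \<notin> B"
    using assms span span_base by blast
  then have "g b = 0" if "b \<in> B" for b
    using g(2) that by auto
  then have "g v = 0" if "v \<in> span S" for v
    using linear_eq_0_on_span[OF g(1)] that span by blast
  with g show thesis
    by (intro that[of g]) auto
qed

text \<open>Functionals separate points: a nonzero \<open>u - v\<close> lies outside
  \<open>span {} = {0}\<close>.\<close>

lemma (in vector_space) eq_if_functionals_eq:
  assumes "\<And>f. linear_functional scale f \<Longrightarrow> f u = f v"
  shows "u = v"
proof (rule ccontr)
  assume "u \<noteq> v"
  then have "u - v \<notin> span {}"
    by simp
  then obtain f where f: "linear_functional scale f" "f (u - v) \<noteq> 0"
    using separating_functional by metis
  then show False
    using assms[OF f(1)] by (simp add: module_hom.diff Vector_Spaces.linear_iff_module_hom)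
qed

text \<open>Turns a map on [A,A], as in (ii), into one on all of A, as in (i): the values of
  \<open>T\<close> on a basis of the span determine \<open>T\<close> there and extend linearly to
  the whole space.\<close>

lemma (in vector_space_pair) linear_map_on_extend:
  assumes "linear_map_on s1 s2 (vs1.span S) T"
  obtains T' where "Vector_Spaces.linear s1 s2 T'" "\<And>v. v \<in> vs1.span S \<Longrightarrow> T' v = T v"
proof -
  obtain B where B: "B \<subseteq> S" "vs1.independent B" "S \<subseteq> vs1.span B"
    using vs1.maximal_independent_subset by blast
  have span: "vs1.span S = vs1.span B"
    using B by (metis vs1.span_mono vs1.span_span subset_antisym)
  obtain T' where T': "Vector_Spaces.linear s1 s2 T'" "\<forall>b\<in>B. T' b = T b"
    using linear_independent_extend[OF B(2)] by blast
  interpret T': Vector_Spaces.linear s1 s2 T'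
    by (fact T'(1))
  have T_add: "T (x + y) = T x + T y" if "x \<in> vs1.span B" "y \<in> vs1.span B" for x y
    using assms that by (simp add: linear_map_on_def span)
  have T_scale: "T (s1 c x) = s2 c (T x)" if "x \<in> vs1.span B" for c x
    using assms that by (simp add: linear_map_on_def span)
  \<comment> \<open>Membership is carried through the induction because \<open>T\<close> is additive
    only inside the span.\<close>
  have "v \<in> vs1.span B \<and> T' v = T v" if "v \<in> vs1.span B" for v
    using that
  proof (induction rule: vs1.span_induct_alt)
    case base
    then show ?case
      using T_scale[of 0 0] by (simp add: vs1.span_zero)
  next
    case (step c x y)
    then show ?case
      using T'(2)
      by (simp add: T_add T_scale T'.add T'.scale vs1.span_add vs1.span_scale vs1.span_base)
  qed
  with T'(1) span show thesis
    by (intro that[of T']) auto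
qed

text \<open>Universal property of the free vector space: weight the coefficients by \<open>g\<close>
  and sum over the finite support.\<close>

lemma linear_functional_free_extend:
  fixes g :: "'k \<Rightarrow> 'f::field"
  obtains G where "linear_functional free_scale G" "\<And>k. G (Poly_Mapping.single k 1) = g k"
proof
  let ?G = "\<lambda>p. Sum_any (\<lambda>k. Poly_Mapping.lookup p k * g k)"
  have fin: "finite {k. Poly_Mapping.lookup p k * g k \<noteq> 0}" for p
    by (rule finite_subset[OF _ finite_lookup[of p]]) auto
  show "linear_functional free_scale ?G"
    unfolding Vector_Spaces.linear_iff
  proof (intro conjI allI vector_space_free_scale vector_space_field)
    show "?G (p + q) = ?G p + ?G q" for p q
      by (simp add: lookup_add distrib_right Sum_any.distrib[OF fin fin])
    show "?G (free_scale c p) = c * ?G p" for c p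
      by (simp add: lookup_free_scale Sum_any_right_distrib[OF fin] mult.assoc)
  qed
  show "?G (Poly_Mapping.single k 1) = g k" for k
    by (simp add: lookup_single when_mult)
qed

section \<open>Membership in the tensor product\<close>

text \<open>Moves spans out of the quotient: the span of the cosets of \<open>G\<close> consists of
  the cosets of the vectors in \<open>span (N \<union> G)\<close>, and this span contains
  \<open>N\<close>, so the representative does not matter.\<close>

lemma (in vector_space) coset_mem_coset_span_iff:
  assumes "subspace N"
  shows "coset N u \<in> coset_span scale N (coset N ` G) \<longleftrightarrow> u \<in> span (N \<union> G)"
proof
  have "\<exists>v. U = coset N v \<and> v \<in> span (N \<union> G)" if "U \<in> coset_span scale N (coset N ` G)" for U
    using that
  proof induction
    case zero
    then show ?case using span_zero by blast
  next
    case (base U)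
    then show ?case using span_base by blast
  next
    case (add U V)
    then show ?case using coset_add_coset[OF assms] span_add by blast
  next
    case (scale U c)
    then show ?case using coset_scale_coset[OF assms] span_scale by blast
  qed
  moreover assume "coset N u \<in> coset_span scale N (coset N ` G)"
  ultimately obtain v where v: "u - v \<in> N" "v \<in> span (N \<union> G)"
    using coset_eq_iff[OF assms] by blast
  then show "u \<in> span (N \<union> G)"
    using span_add[of "u - v" "N \<union> G" v] span_base by auto
next
  assume "u \<in> span (N \<union> G)"
  then show "coset N u \<in> coset_span scale N (coset N ` G)"
  proof (induction rule: span_induct_alt)
    case base
    then show ?case by (rule coset_span.zero)
  next
    case (step c x y)
    have "coset N x \<in> coset_span scale N (coset N ` G)"
    proof (cases "x \<in> N")
      case True
      then have "coset N x = coset N 0"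
        by (simp add: coset_eq_iff[OF assms])
      then show ?thesis by (simp add: coset_span.zero)
    next
      case False
      with step show ?thesis by (auto intro: coset_span.base)
    qed
    then have "coset_add N (coset_scale scale N c (coset N x)) (coset N y)
        \<in> coset_span scale N (coset N ` G)"
      using step by (intro coset_span.add coset_span.scale)
    then show ?case
      by (simp add: coset_add_coset[OF assms] coset_scale_coset[OF assms])
  qed
qed

lemma bilinear_map_iff:
  "bilinear_map s t \<Phi> \<longleftrightarrow> vector_space s \<and> vector_space t \<and>
    (\<forall>x x' y. \<Phi> (x + x') y = \<Phi> x y + \<Phi> x' y) \<and> (\<forall>x y y'. \<Phi> x (y + y') = \<Phi> x y + \<Phi> x y') \<and>
    (\<forall>c x y. \<Phi> (s c x) y = t c (\<Phi> x y)) \<and> (\<forall>c x y. \<Phi> x (s c y) = t c (\<Phi> x y))"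
  unfolding bilinear_map_def Vector_Spaces.linear_iff by blast

lemma ball_Collect_ex3: "(\<forall>p\<in>{f x y z | x y z. True}. P p) \<longleftrightarrow> (\<forall>x y z. P (f x y z))"
  by auto

text \<open>A functional kills a span iff it kills the generators; for the four families of
  generators this says additivity and homogeneity in each argument.\<close>

lemma functional_zero_on_tensor_relations_iff:
  fixes scale :: "'f::field \<Rightarrow> 'a::ring \<Rightarrow> 'a"
  assumes "vector_space scale" and G: "linear_functional free_scale G"
  shows "(\<forall>p\<in>tensor_relations scale. G p = 0) \<longleftrightarrow>
    bilinear_functional scale (\<lambda>x y. G (Poly_Mapping.single (x, y) 1))"
proof -
  interpret vector_space_pair "free_scale :: 'f \<Rightarrow> ('a \<times> 'a \<Rightarrow>\<^sub>0 'f) \<Rightarrow> _" "(*)"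
    by (intro vector_space_pair.intro vector_space_field vector_space_free_scale)
  interpret G: Vector_Spaces.linear free_scale "(*)" G
    by (fact G)
  have "(\<forall>p\<in>vs1.span S. G p = 0) \<longleftrightarrow> (\<forall>p\<in>S. G p = 0)" for S
    using linear_eq_0_on_span[OF G, of S] vs1.span_base by blast
  then show ?thesis
    unfolding tensor_relations_def bilinear_map_iff
    by (simp only: ball_Un ball_Collect_ex3) (simp add: assms(1) vector_space_field G.diff G.add G.scale)
qed

text \<open>Dual description of (A \<otimes> A)_0: bilinear functionals vanishing on zero products
  correspond to functionals on the free space that kill both \<open>?N\<close> and
  \<open>?Z\<close>.\<close>

lemma tensor_diff_mem_zero_products_iff:
  fixes scale :: "'f::field \<Rightarrow> 'a::{ring, monoid_mult} \<Rightarrow> 'a"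
  assumes "vector_space scale"
  shows "tensor_diff scale (tensor scale x y) (tensor scale x' y') \<in> tensor_zero_products scale
    \<longleftrightarrow> (\<forall>\<phi>. bilinear_functional scale \<phi> \<and> vanishes_on_zero_products \<phi> \<longrightarrow> \<phi> x y = \<phi> x' y')"
proof -
  interpret free: vector_space "free_scale :: 'f \<Rightarrow> ('a \<times> 'a \<Rightarrow>\<^sub>0 'f) \<Rightarrow> _"
    by (rule vector_space_free_scale)
  interpret vector_space_pair "free_scale :: 'f \<Rightarrow> ('a \<times> 'a \<Rightarrow>\<^sub>0 'f) \<Rightarrow> _" "(*)"
    by (intro vector_space_pair.intro vector_space_field vector_space_free_scale)
  let ?e = "\<lambda>x y. Poly_Mapping.single (x, y) (1 :: 'f)"
  let ?N = "tensor_relations scale"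
  let ?Z = "{?e x y | x y. x * y = 0 \<and> y * x = 0}"
  have sub: "free.subspace ?N"
    unfolding tensor_relations_def by (rule free.subspace_span)
  have Z: "{tensor scale x y | x y. x * y = 0 \<and> y * x = 0} = coset ?N ` ?Z"
    by (auto simp: tensor_def)
  have mem: "tensor_diff scale (tensor scale x y) (tensor scale x' y') \<in> tensor_zero_products scale
      \<longleftrightarrow> ?e x y - ?e x' y' \<in> free.span (?N \<union> ?Z)"
    unfolding tensor_zero_products_def tensor_span_def Z
    by (simp add: tensor_diff_def tensor_def free.coset_diff_coset[OF sub]
        free.coset_mem_coset_span_iff[OF sub])
  show ?thesis
    unfolding mem
  proof (intro iffI allI impI)
    fix \<phi>
    assume u: "?e x y - ?e x' y' \<in> free.span (?N \<union> ?Z)"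
      and \<phi>: "bilinear_functional scale \<phi> \<and> vanishes_on_zero_products \<phi>"
    obtain G where G: "linear_functional free_scale G" "\<And>k. G (Poly_Mapping.single k 1) = case_prod \<phi> k"
      using linear_functional_free_extend by blast
    have "\<forall>p\<in>?N. G p = 0"
      using functional_zero_on_tensor_relations_iff[OF assms G(1)] \<phi> by (simp add: G(2))
    moreover have "G p = 0" if "p \<in> ?Z" for p
      using that \<phi> by (auto simp: G(2) vanishes_on_zero_products_def)
    ultimately have "G (?e x y - ?e x' y') = 0"
      using linear_eq_0_on_span[OF G(1) _ u] by blast
    then show "\<phi> x y = \<phi> x' y'"
      using linear_diff[OF G(1)] by (simp add: G(2))
  next
    assume eq: "\<forall>\<phi>. bilinear_functional scale \<phi> \<and> vanishes_on_zero_products \<phi> \<longrightarrow> \<phi> x y = \<phi> x' y'"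
    show "?e x y - ?e x' y' \<in> free.span (?N \<union> ?Z)"
    proof (rule ccontr)
      assume "?e x y - ?e x' y' \<notin> free.span (?N \<union> ?Z)"
      \<comment> \<open>The values on the basis of the free space of a functional separating the
        vector from the span give a forbidden \<open>\<phi>\<close>.\<close>
      then obtain G where G: "linear_functional free_scale G"
        "\<And>v. v \<in> free.span (?N \<union> ?Z) \<Longrightarrow> G v = 0" "G (?e x y - ?e x' y') \<noteq> 0"
        using free.separating_functional by blast
      let ?\<phi> = "\<lambda>x y. G (?e x y)"
      have "\<forall>p\<in>?N. G p = 0"
        by (simp add: G(2) free.span_base)
      then have "bilinear_functional scale ?\<phi>"
        by (simp only: functional_zero_on_tensor_relations_iff[OF assms G(1)])
      moreover have "vanishes_on_zero_products ?\<phi>"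
        unfolding vanishes_on_zero_products_def by (auto intro!: G(2) free.span_base)
      ultimately have "?\<phi> x y = ?\<phi> x' y'"
        by (intro eq[rule_format] conjI)
      then show False
        using G(3) linear_diff[OF G(1)] by simp
    qed
  qed
qed

section \<open>The equivalences\<close>

context unital_algebra
begin

lemma commutator_one_right: "commutator x (1 :: 'a) = 0"
  by (simp add: commutator_def)

lemma commutator_mem_commutator_space: "commutator x y \<in> commutator_space scale"
  unfolding commutator_space_def by (intro span_base) auto

text \<open>Since \<open>\<phi> (x * y) 1 = \<tau>1 (x * y) + \<tau>2 (x * y)\<close>, subtracting
  cancels \<open>\<tau>1\<close> and leaves \<open>- \<tau>2\<close> at the commutator.\<close>

lemma two_sided_zpd_functional:
  assumes "two_sided_zpd scale" "bilinear_functional scale \<phi>" "vanishes_on_zero_products \<phi>"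
  obtains \<tau> where "linear_functional scale \<tau>"
    "\<And>x y. \<phi> x y - \<phi> (x * y) 1 = \<tau> (commutator x y)"
proof -
  obtain \<tau>1 \<tau>2 where \<tau>: "linear_functional scale \<tau>1" "linear_functional scale \<tau>2"
    "\<And>x y. \<phi> x y = \<tau>1 (x * y) + \<tau>2 (y * x)"
    using assms unfolding two_sided_zpd_def by blast
  show thesis
  proof
    show "linear_functional scale (\<lambda>u. - \<tau>2 u)"
      using \<tau>(2) by (simp add: Vector_Spaces.linear_iff)
    show "\<phi> x y - \<phi> (x * y) 1 = - \<tau>2 (commutator x y)" for x y
      using \<tau>(2) by (simp add: \<tau>(3) commutator_def module_hom.diff Vector_Spaces.linear_iff_module_hom)
  qed
qed

text \<open>Solving for \<open>\<phi> x y\<close> and splitting \<open>\<tau>\<close> at the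
  commutator gives \<open>\<tau>\<^sub>1 u = \<phi> u 1 + \<tau> u\<close> and
  \<open>\<tau>\<^sub>2 = - \<tau>\<close>.\<close>

lemma two_sided_zpdI:
  assumes "\<And>\<phi>. bilinear_functional scale \<phi> \<Longrightarrow> vanishes_on_zero_products \<phi> \<Longrightarrow>
    \<exists>\<tau>. linear_functional scale \<tau> \<and> (\<forall>x y. \<phi> x y - \<phi> (x * y) 1 = \<tau> (commutator x y))"
  shows "two_sided_zpd scale"
  unfolding two_sided_zpd_def
proof (intro allI impI)
  fix \<phi> :: "'a \<Rightarrow> 'a \<Rightarrow> 'f"
  assume \<phi>: "bilinear_functional scale \<phi> \<and> vanishes_on_zero_products \<phi>"
  then obtain \<tau> where \<tau>: "linear_functional scale \<tau>"
    "\<And>x y. \<phi> x y - \<phi> (x * y) 1 = \<tau> (commutator x y)"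
    using assms by blast
  show "\<exists>\<tau>\<^sub>1 \<tau>\<^sub>2. linear_functional scale \<tau>\<^sub>1 \<and> linear_functional scale \<tau>\<^sub>2 \<and>
      (\<forall>x y. \<phi> x y = \<tau>\<^sub>1 (x * y) + \<tau>\<^sub>2 (y * x))"
  proof (intro exI conjI allI)
    show "linear_functional scale (\<lambda>u. \<phi> u 1 + \<tau> u)"
      using \<phi> \<tau>(1) by (simp add: Vector_Spaces.linear_iff bilinear_map_iff distrib_left)
    show "linear_functional scale (\<lambda>u. - \<tau> u)"
      using \<tau>(1) by (simp add: Vector_Spaces.linear_iff)
    show "\<phi> x y = (\<phi> (x * y) 1 + \<tau> (x * y)) + - \<tau> (y * x)" for x y
    proof -
      have "\<tau> (commutator x y) = \<tau> (x * y) - \<tau> (y * x)"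
        using \<tau>(1) by (simp add: commutator_def module_hom.diff Vector_Spaces.linear_iff_module_hom)
      with \<tau>(2)[of x y] show ?thesis
        by (simp add: diff_eq_eq)
    qed
  qed
qed

section \<open>Equivalence of (i) and (ii)\<close>

lemma two_sided_zpd_imp_factors_via_commutators:
  fixes scaleX :: "'f \<Rightarrow> 'x::ab_group_add \<Rightarrow> 'x"
  assumes zpd: "two_sided_zpd scale" and X: "vector_space scaleX"
  shows "factors_via_commutators scale scaleX"
  unfolding factors_via_commutators_def
proof (intro allI impI)
  fix \<Phi> :: "'a \<Rightarrow> 'a \<Rightarrow> 'x"
  assume \<Phi>: "bilinear_map scale scaleX \<Phi> \<and> vanishes_on_zero_products \<Phi>"
  interpret X: vector_space scaleX by (fact X)
  interpret AX: vector_space_pair scale scaleX ..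
  interpret AF: vector_space_pair scale "(*)"
    by (intro vector_space_pair.intro vector_space_field vector_space_axioms)
  let ?C = "{commutator x y | x y. True}"
  \<comment> \<open>A basis of [A,A] made of commutators lets \<open>T\<close> be prescribed by
    choosing one representation \<open>commutator x y\<close> of each basis element.\<close>
  obtain B where B: "B \<subseteq> ?C" "independent B" "?C \<subseteq> span B"
    using maximal_independent_subset by blast
  have "\<forall>b\<in>B. \<exists>v x y. b = commutator x y \<and> v = \<Phi> x y - \<Phi> (x * y) 1"
    using B(1) by blast
  from bchoice[OF this] obtain t
    where t: "\<And>b. b \<in> B \<Longrightarrow> \<exists>x y. b = commutator x y \<and> t b = \<Phi> x y - \<Phi> (x * y) 1"
    by blast
  obtain T where T: "Vector_Spaces.linear scale scaleX T" "\<And>b. b \<in> B \<Longrightarrow> T b = t b"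
    using AX.linear_independent_extend[OF B(2)] by blast
  have "\<Phi> x y - \<Phi> (x * y) 1 = T (commutator x y)" for x y
  \<comment> \<open>That the chosen representations do not matter is checked after applying each
    functional \<open>f\<close> on X, where the scalar case applies.\<close>
  proof (rule X.eq_if_functionals_eq)
    fix f assume f: "linear_functional scaleX f"
    interpret f: Vector_Spaces.linear scaleX "(*)" f by (fact f)
    have "bilinear_functional scale (\<lambda>x y. f (\<Phi> x y))"
      using \<Phi> vector_space_field by (simp add: bilinear_map_iff f.add f.scale)
    moreover have "vanishes_on_zero_products (\<lambda>x y. f (\<Phi> x y))"
      using \<Phi> by (simp add: vanishes_on_zero_products_def f.zero)
    ultimately obtain \<tau> where \<tau>: "linear_functional scale \<tau>"
      "\<And>x y. f (\<Phi> x y) - f (\<Phi> (x * y) 1) = \<tau> (commutator x y)"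
      using two_sided_zpd_functional[OF zpd] by metis
    have fT: "linear_functional scale (\<lambda>u. f (T u))"
      using T(1) f by (simp add: Vector_Spaces.linear_iff)
    \<comment> \<open>The formula for \<open>\<tau>\<close> holds for every pair, hence for the pair
      chosen to represent \<open>b\<close>.\<close>
    have "f (T b) = \<tau> b" if "b \<in> B" for b
      using t[OF that] T(2)[OF that] \<tau>(2) by (auto simp: f.diff)
    moreover have "commutator x y \<in> span B"
      using B(3) by blast
    ultimately have "f (T (commutator x y)) = \<tau> (commutator x y)"
      using AF.linear_eq_on[OF fT \<tau>(1)] by blast
    then show "f (\<Phi> x y - \<Phi> (x * y) 1) = f (T (commutator x y))"
      using \<tau>(2) by (simp add: f.diff)
  qed
  moreover have "linear_map_on scale scaleX (commutator_space scale) T"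
    using T(1) by (simp add: linear_map_on_def Vector_Spaces.linear_iff)
  ultimately show "\<exists>T. linear_map_on scale scaleX (commutator_space scale) T \<and>
      (\<forall>x y. \<Phi> x y - \<Phi> (x * y) 1 = T (commutator x y))"
    by blast
qed

lemma factors_via_commutators_imp_two_sided_zpd:
  assumes "factors_via_commutators scale ((*) :: 'f \<Rightarrow> 'f \<Rightarrow> 'f)"
  shows "two_sided_zpd scale"
proof (rule two_sided_zpdI)
  fix \<phi> :: "'a \<Rightarrow> 'a \<Rightarrow> 'f"
  assume "bilinear_functional scale \<phi>" "vanishes_on_zero_products \<phi>"
  then obtain T where T: "linear_map_on scale (*) (commutator_space scale) T"
    "\<And>x y. \<phi> x y - \<phi> (x * y) 1 = T (commutator x y)"
    using assms unfolding factors_via_commutators_def by blast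
  interpret AF: vector_space_pair scale "(*)"
    by (intro vector_space_pair.intro vector_space_field vector_space_axioms)
  \<comment> \<open>\<open>T\<close> is linear only on [A,A], while \<open>two_sided_zpdI\<close>
    asks for a functional on all of A.\<close>
  obtain \<tau> where \<tau>: "linear_functional scale \<tau>" "\<And>v. v \<in> commutator_space scale \<Longrightarrow> \<tau> v = T v"
    using AF.linear_map_on_extend[OF T(1)[unfolded commutator_space_def], folded commutator_space_def]
    by blast
  have "\<phi> x y - \<phi> (x * y) 1 = \<tau> (commutator x y)" for x y
    unfolding \<tau>(2)[OF commutator_mem_commutator_space] by (rule T(2))
  with \<tau>(1) show "\<exists>\<tau>. linear_functional scale \<tau> \<and> (\<forall>x y. \<phi> x y - \<phi> (x * y) 1 = \<tau> (commutator x y))"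
    by blast
qed

section \<open>Equivalence of (i) and (iii)\<close>

lemma two_sided_zpd_imp_zero_Lie_product_determined:
  assumes "two_sided_zpd scale"
  shows "zero_Lie_product_determined scale"
  unfolding zero_Lie_product_determined_def
proof (intro allI impI)
  fix \<phi> :: "'a \<Rightarrow> 'a \<Rightarrow> 'f"
  assume \<phi>: "bilinear_functional scale \<phi> \<and> (\<forall>x y. commutator x y = 0 \<longrightarrow> \<phi> x y = 0)"
  then have "vanishes_on_zero_products \<phi>"
    by (simp add: vanishes_on_zero_products_def commutator_def)
  then obtain \<tau> where "linear_functional scale \<tau>"
    "\<And>x y. \<phi> x y - \<phi> (x * y) 1 = \<tau> (commutator x y)"
    using two_sided_zpd_functional[OF assms] \<phi> by metis
  \<comment> \<open>Everything commutes with 1, so the correction term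
    \<open>\<phi> (x * y) 1\<close> drops out.\<close>
  moreover have "\<phi> x 1 = 0" for x
    using \<phi> commutator_one_right by blast
  ultimately show "\<exists>\<tau>. linear_functional scale \<tau> \<and> (\<forall>x y. \<phi> x y = \<tau> (commutator x y))"
    by auto
qed

lemma two_sided_zpd_iff_zero_Lie_product_determined:
  "two_sided_zpd scale \<longleftrightarrow> zero_Lie_product_determined scale \<and>
    (\<forall>z w. commutator z w = 0 \<longrightarrow>
      tensor_diff scale (tensor scale z w) (tensor scale (z * w) 1) \<in> tensor_zero_products scale)"
  \<comment> \<open>From here on the tensor condition is a statement about bilinear functionals on
    A.\<close>
  unfolding tensor_diff_mem_zero_products_iff[OF vector_space_axioms]
proof (intro iffI conjI allI impI)
  assume zpd: "two_sided_zpd scale"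
  then show "zero_Lie_product_determined scale"
    by (rule two_sided_zpd_imp_zero_Lie_product_determined)
  fix z w :: 'a and \<phi> :: "'a \<Rightarrow> 'a \<Rightarrow> 'f"
  assume zw: "commutator z w = 0"
    and \<phi>: "bilinear_functional scale \<phi> \<and> vanishes_on_zero_products \<phi>"
  obtain \<tau> where \<tau>: "linear_functional scale \<tau>"
    "\<And>x y. \<phi> x y - \<phi> (x * y) 1 = \<tau> (commutator x y)"
    using two_sided_zpd_functional[OF zpd] \<phi> by metis
  have "\<tau> 0 = 0"
    using \<tau>(1) by (simp add: module_hom.zero Vector_Spaces.linear_iff_module_hom)
  then show "\<phi> z w = \<phi> (z * w) 1"
    using \<tau>(2)[of z w] zw by simp
next
  assume asm: "zero_Lie_product_determined scale \<and>
    (\<forall>z w. commutator z w = 0 \<longrightarrow> (\<forall>\<phi>. bilinear_functional scale \<phi> \<and>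
      vanishes_on_zero_products \<phi> \<longrightarrow> \<phi> z w = \<phi> (z * w) 1))"
  show "two_sided_zpd scale"
  proof (rule two_sided_zpdI)
    fix \<phi> :: "'a \<Rightarrow> 'a \<Rightarrow> 'f"
    assume \<phi>: "bilinear_functional scale \<phi>" "vanishes_on_zero_products \<phi>"
    \<comment> \<open>The tensor condition makes this corrected form vanish on all commuting pairs,
      not only on zero products, so the zLpd property applies to it.\<close>
    let ?\<psi> = "\<lambda>x y. \<phi> x y - \<phi> (x * y) 1"
    have "bilinear_functional scale ?\<psi>"
      using \<phi>(1)
      by (simp add: bilinear_map_iff distrib_left distrib_right mult_scale_left mult_scale_right
          right_diff_distrib)
    moreover have "\<forall>x y. commutator x y = 0 \<longrightarrow> ?\<psi> x y = 0"
      using asm \<phi> by auto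
    ultimately show "\<exists>\<tau>. linear_functional scale \<tau> \<and> (\<forall>x y. ?\<psi> x y = \<tau> (commutator x y))"
      using asm[THEN conjunct1, unfolded zero_Lie_product_determined_def, rule_format, of ?\<psi>]
      by blast
  qed
qed

end

theorem theorem2p5:
  fixes scale :: "'f::field \<Rightarrow> 'a::{ring, monoid_mult} \<Rightarrow> 'a"
  assumes "unital_algebra scale"
  shows "(two_sided_zpd scale \<longleftrightarrow>
      factors_via_commutators scale ((*) :: 'f \<Rightarrow> 'f \<Rightarrow> 'f) \<and>
      (\<forall>scaleX :: 'f \<Rightarrow> 'x::ab_group_add \<Rightarrow> 'x.
        vector_space scaleX \<longrightarrow> factors_via_commutators scale scaleX)) \<and>
    (two_sided_zpd scale \<longleftrightarrow>
      zero_Lie_product_determined scale \<and>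
      (\<forall>z w. commutator z w = 0 \<longrightarrow>
        tensor_diff scale (tensor scale z w) (tensor scale (z * w) 1) \<in> tensor_zero_products scale))"
proof -
  interpret unital_algebra scale by (fact assms)
  show ?thesis
    \<comment> \<open>The implication from (i) to (ii) enters at two types: X = F, and the arbitrary
      \<open>'x\<close>.\<close>
    using two_sided_zpd_imp_factors_via_commutators[OF _ vector_space_field]
      two_sided_zpd_imp_factors_via_commutators
      factors_via_commutators_imp_two_sided_zpd two_sided_zpd_iff_zero_Lie_product_determined
    by blast
qed

end
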